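(* Let $m$ be a positive integer and $n = 4m-1$. Then $p_n \ge 2 - \frac{1}{3\cdot 2^{m-1}-1}$. Equivalently: there exist real numbers $a_1,\dots,a_n\in[0,1]$ such that for every choice of signs $e_1,\dots,e_n\in\{-1,+1\}$, with $s_0=0$ and $s_i=\sum_{k=1}^i e_k a_k$ for $1\le i\le n$, we have $\max_{0\le k\le n} s_k - \min_{0\le k\le n} s_k \ge 2 - \frac{1}{3\cdot 2^{m-1}-1}$.
   Context: For a positive integer $n$, signs $e_1,\dots,e_n\in\{-1,+1\}$ and reals $a_1,\dots,a_n\in[0,1]$, set $s_0=0$ and $s_i=\sum_{k=1}^i e_k a_k$ for $1\le i\le n$. The range is $g(e_1,\dots,e_n,a_1,\dots,a_n)=\max_{0\le k\le n}s_k-\min_{0\le k\le n}s_k$. The step-cover is $f(a_1,\dots,a_n)=\min_{e_1,\dots,e_n\in\{-1,+1\}} g(e_1,\dots,e_n,a_1,\dots,a_n)$. The fit is $p_n=\max_{a_1,\dots,a_n\in[0,1]} f(a_1,\dots,a_n)$. *)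

theory Defs
  imports "HOL-Analysis.Analysis"
begin

text \<open>
  Finite sequences \<open>x\<^sub>1, \<dots>, x\<^sub>n\<close> are functions \<^typ>\<open>nat \<Rightarrow> real\<close> of which only the
  values on \<open>{1..n}\<close> matter.
\<close>

definition partial_sum :: "(nat \<Rightarrow> real) \<Rightarrow> (nat \<Rightarrow> real) \<Rightarrow> nat \<Rightarrow> real" where
  "partial_sum e a i = (\<Sum>k = 1..i. e k * a k)"

definition walk_range :: "nat \<Rightarrow> (nat \<Rightarrow> real) \<Rightarrow> (nat \<Rightarrow> real) \<Rightarrow> real" where
  "walk_range n e a = Max (partial_sum e a ` {0..n}) - Min (partial_sum e a ` {0..n})"

text \<open>The extensional function space keeps the set of sign vectors finite, as \<^const>\<open>Min\<close> needs.\<close>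

definition step_cover :: "nat \<Rightarrow> (nat \<Rightarrow> real) \<Rightarrow> real" where
  "step_cover n a = Min ((\<lambda>e. walk_range n e a) ` ({1..n} \<rightarrow>\<^sub>E {-1, 1}))"

text \<open>
  \<^const>\<open>Max\<close> is only meaningful on finite sets, hence the supremum;
  lemma \<open>fit_attained\<close> shows that it is a maximum.
\<close>

definition fit :: "nat \<Rightarrow> real" where
  "fit n = (SUP a \<in> {1..n} \<rightarrow>\<^sub>E {0..1}. step_cover n a)"

lemma continuous_on_Max_image:
  fixes F :: "'i \<Rightarrow> 'a::topological_space \<Rightarrow> real"
  assumes "finite I" "I \<noteq> {}" "\<And>i. i \<in> I \<Longrightarrow> continuous_on S (F i)"
  shows "continuous_on S (\<lambda>x. Max ((\<lambda>i. F i x) ` I))"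
  using assms
proof (induction I rule: finite_ne_induct)
  case (insert j I)
  then have "continuous_on S (\<lambda>x. max (F j x) (Max ((\<lambda>i. F i x) ` I)))"
    by (intro continuous_on_max) auto
  with insert show ?case by simp
qed simp

lemma continuous_on_Min_image:
  fixes F :: "'i \<Rightarrow> 'a::topological_space \<Rightarrow> real"
  assumes "finite I" "I \<noteq> {}" "\<And>i. i \<in> I \<Longrightarrow> continuous_on S (F i)"
  shows "continuous_on S (\<lambda>x. Min ((\<lambda>i. F i x) ` I))"
  using assms
proof (induction I rule: finite_ne_induct)
  case (insert j I)
  then have "continuous_on S (\<lambda>x. min (F j x) (Min ((\<lambda>i. F i x) ` I)))"
    by (intro continuous_on_min) auto
  with insert show ?case by simp
qed simp

lemma continuous_on_step_cover: "continuous_on S (step_cover n)"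
proof -
  have ps: "continuous_on S (\<lambda>a. partial_sum e a k)" for e k
    unfolding partial_sum_def
    by (intro continuous_intros continuous_on_subset[OF continuous_on_product_coordinates]) auto
  have "continuous_on S (walk_range n e)" for e
    unfolding walk_range_def
    by (intro continuous_on_diff continuous_on_Max_image continuous_on_Min_image ps) auto
  then show ?thesis
    unfolding step_cover_def
    by (intro continuous_on_Min_image) (auto intro!: finite_PiE simp: PiE_eq_empty_iff)
qed

lemma compact_unit_cube: "compact ({1..n} \<rightarrow>\<^sub>E {0..1::real})"
proof -
  have "{1..n} \<rightarrow>\<^sub>E {0..1::real} = Pi\<^sub>E UNIV (\<lambda>i. if i \<in> {1..n} then {0..1} else {undefined})"
    (is "_ = ?P")
    by (auto simp: PiE_iff extensional_def split: if_splits) 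
  moreover have "compactin (product_topology (\<lambda>_. euclidean) UNIV) ?P"
    unfolding compactin_PiE by auto
  ultimately show ?thesis
    by (simp add: euclidean_product_topology)
qed

lemma fit_attained: "\<exists>a \<in> {1..n} \<rightarrow>\<^sub>E {0..1}. fit n = step_cover n a"
proof -
  have "{1..n} \<rightarrow>\<^sub>E {0..1::real} \<noteq> {}"
    by (auto simp: PiE_eq_empty_iff)
  then obtain a where a: "a \<in> {1..n} \<rightarrow>\<^sub>E {0..1}"
      and le: "\<And>b. b \<in> {1..n} \<rightarrow>\<^sub>E {0..1} \<Longrightarrow> step_cover n b \<le> step_cover n a"
    using continuous_attains_sup[OF compact_unit_cube _ continuous_on_step_cover] by metis
  have "fit n = step_cover n a"
    unfolding fit_def using a le by (intro cSup_eq_maximum) auto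
  with a show ?thesis by blast
qed

end

theory Submission
  imports Defs
begin

text \<open>
  Put \<open>D = 3 \<cdot> 2 ^ (m - 1) - 1\<close> and scale all steps by \<open>D\<close>. The witness alternates full steps \<open>D\<close>
  with the steps \<open>D - b\<close>, where \<open>b\<close> runs through \<open>1, 2, 4, \<dots>, 2 ^ (m - 1), \<dots>, 4, 2, 1\<close>.
  A walk of range less than \<open>2 D - 1\<close>, centred at the midpoint of its range, stays in
  \<open>\<bar>x\<bar> < D - 1/2\<close>, so a step always goes towards the origin unless the walker is close to it.
  A full step turns \<open>\<bar>x\<bar> < D - c + 1/2\<close> into \<open>\<bar>x\<bar> > c - 1/2\<close>. While \<open>b\<close> increases, a step
  \<open>D - b\<close> turns \<open>\<bar>x\<bar> > b - 1/2\<close> into \<open>\<bar>x\<bar> < D - 2 b + 1/2\<close>, so that the walker is pushed away from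
  the origin after each full step; at \<open>b = 2 ^ (m - 1)\<close> the latter bound is \<open>\<bar>x\<bar> < b - 1/2\<close>. While \<open>b\<close>
  decreases, the two steps turn \<open>\<bar>x\<bar> < 2 b - 1/2\<close> into \<open>\<bar>x\<bar> < b - 1/2\<close>. In the end
  \<open>\<bar>x\<bar> < 1/2\<close>, and the last full step leaves the admissible interval.
\<close>

lemma walk_range_bound:
  assumes "k \<le> n"
  shows "\<bar>partial_sum e a k -
      (Max (partial_sum e a ` {0..n}) + Min (partial_sum e a ` {0..n})) / 2\<bar> \<le> walk_range n e a / 2"
proof -
  let ?P = "partial_sum e a ` {0..n}"
  have "partial_sum e a k \<le> Max ?P" "Min ?P \<le> partial_sum e a k"
    using assms by auto
  then show ?thesis
    unfolding walk_range_def by (simp add: abs_le_iff field_simps)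
qed

lemma abs_partial_sum_Suc_diff:
  assumes "e (Suc k) \<in> {-1, 1}"
  shows "\<bar>partial_sum e a (Suc k) - partial_sum e a k\<bar> = \<bar>a (Suc k)\<bar>"
  using assms unfolding partial_sum_def by auto

lemma walk_range_cong:
  assumes "\<And>k. k \<in> {1..n} \<Longrightarrow> a k = b k"
  shows "walk_range n e a = walk_range n e b"
proof -
  have "partial_sum e a ` {0..n} = partial_sum e b ` {0..n}"
    unfolding partial_sum_def using assms by (intro image_cong sum.cong) auto
  then show ?thesis
    unfolding walk_range_def by simp
qed

text \<open>\<open>SUP\<close> bounds its members because the image of the compact cube under a
  continuous map is bounded.\<close>

lemma step_cover_le_fit:
  assumes "a \<in> {1..n} \<rightarrow>\<^sub>E {0..1}"
  shows "step_cover n a \<le> fit n"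
  unfolding fit_def using assms
  by (intro cSUP_upper bounded_imp_bdd_above compact_imp_bounded
      compact_continuous_image continuous_on_step_cover compact_unit_cube)

lemma step_cover_ge:
  assumes "\<And>e. (\<forall>i \<in> {1..n}. e i \<in> {-1, 1}) \<Longrightarrow> c \<le> walk_range n e a"
  shows "c \<le> step_cover n a"
  unfolding step_cover_def using assms
  by (subst Min_ge_iff) (auto intro!: finite_PiE simp: PiE_eq_empty_iff PiE_iff)

text \<open>\<open>x\<close> stands for the centred walk scaled by \<open>D\<close>. The exponents
  are 0, ..., m - 1 in \<open>up\<close> and m - 2, ..., 0 in \<open>down\<close>, so the peak
  occurs once.\<close>

lemma no_confined_walk:
  fixes x :: "nat \<Rightarrow> real" and D :: real
  assumes m: "m \<ge> 1" and D: "D = 3 * 2 ^ (m - 1) - 1"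
    and confined: "\<And>k. k \<le> 4 * m - 1 \<Longrightarrow> \<bar>x k\<bar> < D - 1/2"
    and full: "\<And>j. j < 2 * m \<Longrightarrow> \<bar>x (2 * j + 1) - x (2 * j)\<bar> = D"
    and up: "\<And>j. j < m \<Longrightarrow> \<bar>x (2 * j + 2) - x (2 * j + 1)\<bar> = D - 2 ^ j"
    and down: "\<And>t. t + 1 < m \<Longrightarrow>
      \<bar>x (2 * (m + t) + 2) - x (2 * (m + t) + 1)\<bar> = D - 2 ^ (m - 2 - t)"
  shows False
proof -
  have up_step: "\<bar>x (2 * j + 2)\<bar> < D - 2 * 2 ^ j + 1/2"
    if "j < m" and "\<bar>x (2 * j + 1)\<bar> > 2 ^ j - 1/2" for j
  proof -
    \<comment> \<open>An outward step would end beyond \<open>D - 1/2\<close>. An inward step that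
      does not cross 0 ends below \<open>2 ^ j - 1/2\<close>, which is within the claim since
      \<open>3 * 2 ^ j - 1\<close> \<le> \<open>D\<close>. Equality at \<open>j = m - 1\<close>
      explains the choice of \<open>D\<close>.\<close>
    have "(2::real) ^ j \<le> 2 ^ (m - 1)"
      using that by (intro power_increasing) auto
    moreover have "\<bar>x (2 * j + 1)\<bar> < D - 1/2" "\<bar>x (2 * j + 2)\<bar> < D - 1/2"
      using that m by (auto intro!: confined)
    ultimately show ?thesis
      using that up[of j] D by linarith
  qed
  have increasing: "\<bar>x (2 * j + 1)\<bar> > 2 ^ j - 1/2" if "j < m" for j
    using that
  proof (induction j)
    case 0
    then show ?case using full[of 0] confined[of 0] by simp
  next
    case (Suc j)
    then have "\<bar>x (2 * j + 2)\<bar> < D - 2 * 2 ^ j + 1/2"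
      by (intro up_step) auto
    with full[of "Suc j"] Suc.prems show ?case by simp
  qed
  have decreasing: "\<bar>x (2 * (m + t))\<bar> < 2 ^ (m - 1 - t) - 1/2" if "t < m" for t
    using that
  proof (induction t)
    case 0
    have "\<bar>x (2 * (m - 1) + 2)\<bar> < D - 2 * 2 ^ (m - 1) + 1/2"
      using m by (intro up_step increasing) auto
    moreover have "2 * (m - 1) + 2 = 2 * m" using m by simp
    ultimately show ?case using D by simp
  next
    case (Suc t)
    define b :: real where "b = 2 ^ (m - 2 - t)"
    have "m - 1 - t = Suc (m - 2 - t)" using Suc.prems by simp
    then have b2: "2 ^ (m - 1 - t) = 2 * b" by (simp add: b_def)
    have "(2::real) ^ (m - 1 - t) \<le> 2 ^ (m - 1)"
      by (intro power_increasing) auto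
    moreover have "b \<ge> 1" by (simp add: b_def)
    ultimately have bD: "3 * b < D" "b \<ge> 1" using b2 D by linarith+
    have 1: "\<bar>x (2 * (m + t))\<bar> < 2 * b - 1/2" using Suc b2 by simp
    have 2: "\<bar>x (2 * (m + t) + 1) - x (2 * (m + t))\<bar> = D"
      using Suc.prems by (intro full) auto
    have 3: "\<bar>x (2 * (m + t) + 2) - x (2 * (m + t) + 1)\<bar> = D - b"
      unfolding b_def using Suc.prems by (intro down) auto
    have "\<bar>x (2 * (m + t) + 1)\<bar> < D - 1/2" "\<bar>x (2 * (m + t) + 2)\<bar> < D - 1/2"
      using Suc.prems by (auto intro!: confined)
    \<comment> \<open>After the full step the distance from 0 lies between
      \<open>D - 2 * b + 1/2\<close> and \<open>D - 1/2\<close>, an interval with centre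
      \<open>D - b\<close> and radius \<open>b - 1/2\<close>. As \<open>3 * b < D\<close>, the next
      step cannot go outward.\<close>
    with 1 2 3 bD have "\<bar>x (2 * (m + t) + 2)\<bar> < b - 1/2" by linarith
    then show ?case using Suc.prems by (simp add: b_def)
  qed
  let ?k = "2 * (m + (m - 1))"
  have "\<bar>x ?k\<bar> < 1/2" using decreasing[of "m - 1"] m by simp
  moreover have "\<bar>x (?k + 1) - x ?k\<bar> = D" using m by (intro full) auto
  moreover have "\<bar>x (?k + 1)\<bar> < D - 1/2" using m by (intro confined) auto
  ultimately show False by linarith
qed

text \<open>At \<open>i = 2 * j + 2\<close> the exponent is the minimum of \<open>j\<close> and
  \<open>2 * m - 2 - j\<close>: it rises from 0 to \<open>m - 1\<close> and is 0 again at
  \<open>i = 4 * m - 2\<close>.\<close>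

definition steps :: "nat \<Rightarrow> nat \<Rightarrow> real" where
  "steps m i = (if odd i then 1
     else 1 - 2 ^ min (i div 2 - 1) (2 * m - 1 - i div 2) / (3 * 2 ^ (m - 1) - 1))"

lemma steps_mem: "steps m i \<in> {0..1}"
proof -
  have "min (i div 2 - 1) (2 * m - 1 - i div 2) \<le> m - 1" by auto
  then have "(2::real) ^ min (i div 2 - 1) (2 * m - 1 - i div 2) \<le> 2 ^ (m - 1)"
    by (intro power_increasing) auto
  moreover have "(1::real) \<le> 2 ^ (m - 1)" by simp
  ultimately have "(2::real) ^ min (i div 2 - 1) (2 * m - 1 - i div 2) \<le> 3 * 2 ^ (m - 1) - 1"
    "(0::real) < 3 * 2 ^ (m - 1) - 1"
    by linarith+
  then show ?thesis by (simp add: steps_def divide_le_eq)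
qed

lemma walk_range_steps:
  assumes m: "m \<ge> 1" and n: "n = 4 * m - 1" and e: "\<forall>i \<in> {1..n}. e i \<in> {-1, 1}"
  shows "walk_range n e (steps m) \<ge> 2 - 1 / (3 * 2 ^ (m - 1) - 1)"
proof (rule ccontr)
  define D :: real where "D = 3 * 2 ^ (m - 1) - 1"
  let ?P = "partial_sum e (steps m) ` {0..n}"
  \<comment> \<open>Subtracting the midpoint leaves step lengths unchanged and bounds the walk by
    half its range.\<close>
  define x where "x k = D * (partial_sum e (steps m) k - (Max ?P + Min ?P) / 2)" for k
  assume "\<not> ?thesis"
  then have range: "walk_range n e (steps m) < 2 - 1 / D" by (simp add: D_def)
  have "(1::real) \<le> 2 ^ (m - 1)" by simp
  then have D0: "D > 0" unfolding D_def by linarith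
  have confined: "\<bar>x k\<bar> < D - 1/2" if "k \<le> n" for k
  proof -
    have "\<bar>x k\<bar> \<le> D * (walk_range n e (steps m) / 2)"
      unfolding x_def abs_mult using D0 walk_range_bound[OF that, of e "steps m"] by simp
    also have "\<dots> < D * ((2 - 1 / D) / 2)"
      using D0 range by simp
    also have "\<dots> = D - 1/2" using D0 by (simp add: field_simps)
    finally show ?thesis .
  qed
  have step: "\<bar>x (Suc k) - x k\<bar> = D * steps m (Suc k)" if "Suc k \<le> n" for k
  proof -
    have "x (Suc k) - x k = D * (partial_sum e (steps m) (Suc k) - partial_sum e (steps m) k)"
      by (simp add: x_def algebra_simps)
    then show ?thesis
      using abs_partial_sum_Suc_diff[of e k "steps m"] e that D0 steps_mem[of m "Suc k"]
      by (simp add: abs_mult)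
  qed
  have even_step: "D * steps m i = D - 2 ^ min (i div 2 - 1) (2 * m - 1 - i div 2)" if "even i" for i
    unfolding steps_def D_def[symmetric] using D0 that by (simp add: field_simps)
  show False
  proof (rule no_confined_walk[OF m D_def, of x])
    show "\<bar>x k\<bar> < D - 1/2" if "k \<le> 4 * m - 1" for k
      using confined that n by simp
    show "\<bar>x (2 * j + 1) - x (2 * j)\<bar> = D" if "j < 2 * m" for j
      using step[of "2 * j"] that n by (simp add: steps_def)
    show "\<bar>x (2 * j + 2) - x (2 * j + 1)\<bar> = D - 2 ^ j" if "j < m" for j
    proof -
      have "min ((2 * j + 2) div 2 - 1) (2 * m - 1 - (2 * j + 2) div 2) = j"
        using that by simp
      then have "D * steps m (2 * j + 2) = D - 2 ^ j"
        by (subst even_step) simp_all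
      then show ?thesis using step[of "2 * j + 1"] that n by simp
    qed
    show "\<bar>x (2 * (m + t) + 2) - x (2 * (m + t) + 1)\<bar> = D - 2 ^ (m - 2 - t)" if "t + 1 < m" for t
    proof -
      have "min ((2 * (m + t) + 2) div 2 - 1) (2 * m - 1 - (2 * (m + t) + 2) div 2) = m - 2 - t"
        using that by simp
      then have "D * steps m (2 * (m + t) + 2) = D - 2 ^ (m - 2 - t)"
        by (subst even_step) simp_all
      then show ?thesis using step[of "2 * (m + t) + 1"] that n by simp
    qed
  qed
qed

theorem theorem2:
  fixes m n :: nat
  assumes "m \<ge> 1" and "n = 4 * m - 1"
  shows "fit n \<ge> 2 - 1 / (3 * 2 ^ (m - 1) - 1) \<and>
    (\<exists>a :: nat \<Rightarrow> real. (\<forall>i \<in> {1..n}. a i \<in> {0..1}) \<and>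
       (\<forall>e :: nat \<Rightarrow> real. (\<forall>i \<in> {1..n}. e i \<in> {-1, 1}) \<longrightarrow>
          walk_range n e a \<ge> 2 - 1 / (3 * 2 ^ (m - 1) - 1)))"
proof -
  \<comment> \<open>\<open>fit\<close> ranges over extensional functions, hence the restriction;
    \<open>walk_range\<close> does not see it.\<close>
  define a where "a = restrict (steps m) {1..n}"
  have a: "a \<in> {1..n} \<rightarrow>\<^sub>E {0..1}"
    unfolding a_def using steps_mem[of m] by (intro restrict_PiE_iff[THEN iffD2]) auto
  have range: "walk_range n e a \<ge> 2 - 1 / (3 * 2 ^ (m - 1) - 1)"
    if "\<forall>i \<in> {1..n}. e i \<in> {-1, 1}" for e
    using walk_range_steps[OF assms that] walk_range_cong[of n a "steps m" e]
    by (simp add: a_def)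
  have "2 - 1 / (3 * 2 ^ (m - 1) - 1) \<le> step_cover n a"
    by (rule step_cover_ge) (rule range)
  also have "\<dots> \<le> fit n" by (rule step_cover_le_fit[OF a])
  finally show ?thesis using a range by blast
qed

end
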